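(* Let $X$ be a non-negative DGMRD random variable with continuous distribution function, unbounded support ($H=+\infty$) and $\mathbb{E}X<+\infty$, and let $c:=\lim_{x\to+\infty}\ell(x)$. If $\beta>0$, then $c<\frac{1}{\beta}$ if and only if $\mathbb{E}X^{\beta+1}<+\infty$. In particular, $c=0$ if and only if $\mathbb{E}X^{\beta+1}<+\infty$ for every $\beta>0$.
   Context: Let $F$ be the distribution function of $X$, $\bar F:=1-F$, and $H:=\inf\{x\ge 0: F(x)=1\}\le+\infty$. The mean residual demand (MRD) function is $\mathrm{m}(x):=\mathbb{E}(X-x\mid X>x)=\frac{1}{\bar F(x)}\int_x^{+\infty}\bar F(u)\,du$ for $x<H$. The generalized mean residual demand (GMRD) function is $\ell(x):=\mathrm{m}(x)/x$ for $0<x<H$. $X$ is DGMRD (decreasing generalized mean residual demand) if $\ell$ is non-increasing on $(0,H)$. *)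

theory Defs
  imports "HOL-Probability.Probability"
begin

definition dist_fun :: "'a measure \<Rightarrow> ('a \<Rightarrow> real) \<Rightarrow> real \<Rightarrow> real" where
  "dist_fun M X = cdf (distr M borel X)"

definition upper_endpoint :: "'a measure \<Rightarrow> ('a \<Rightarrow> real) \<Rightarrow> ereal" where
  "upper_endpoint M X = Inf (ereal ` {x. 0 \<le> x \<and> dist_fun M X x = 1})"

(* uniform_measure M A is M conditioned on the event A, so this is E(X - x | X > x).
   It is meaningful only when X is integrable and x lies below the upper endpoint. *)
definition mrd :: "'a measure \<Rightarrow> ('a \<Rightarrow> real) \<Rightarrow> real \<Rightarrow> real" where
  "mrd M X x = integral\<^sup>L (uniform_measure M {\<omega> \<in> space M. x < X \<omega>}) (\<lambda>\<omega>. X \<omega> - x)"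

definition gmrd :: "'a measure \<Rightarrow> ('a \<Rightarrow> real) \<Rightarrow> real \<Rightarrow> real" where
  "gmrd M X x = mrd M X x / x"

definition DGMRD :: "'a measure \<Rightarrow> ('a \<Rightarrow> real) \<Rightarrow> bool" where
  "DGMRD M X \<longleftrightarrow> antimono_on {x. 0 < x \<and> ereal x < upper_endpoint M X} (gmrd M X)"

lemma (in prob_space) mrd_eq_tail_integral:
  fixes X :: "'a \<Rightarrow> real"
  assumes "integrable M X" "0 \<le> x" "ereal x < upper_endpoint M X"
  shows "mrd M X x = (LBINT u:{x<..}. 1 - dist_fun M X u) / (1 - dist_fun M X x)"
proof -
  have [measurable]: "X \<in> borel_measurable M" using assms(1) by simp
  define A where "A = {\<omega> \<in> space M. x < X \<omega>}"
  have [measurable]: "A \<in> sets M" unfolding A_def by measurable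
  have tail: "1 - dist_fun M X u = prob {\<omega> \<in> space M. u < X \<omega>}" for u
  proof -
    have "dist_fun M X u = prob {\<omega> \<in> space M. X \<omega> \<le> u}"
      unfolding dist_fun_def cdf_def
      by (subst measure_distr) (auto intro!: arg_cong[where f = prob])
    moreover have "prob (space M - {\<omega> \<in> space M. X \<omega> \<le> u}) = 1 - prob {\<omega> \<in> space M. X \<omega> \<le> u}"
      by (rule prob_compl) measurable
    moreover have "space M - {\<omega> \<in> space M. X \<omega> \<le> u} = {\<omega> \<in> space M. u < X \<omega>}" by auto
    ultimately show ?thesis by simp
  qed
  have ne: "dist_fun M X x \<noteq> 1"
  proof
    assume "dist_fun M X x = 1"
    then have "upper_endpoint M X \<le> ereal x"
      unfolding upper_endpoint_def using assms(2) by (intro Inf_lower) auto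
    with assms(3) show False by simp
  qed
  have pos: "prob A > 0"
    using ne tail[of x] measure_nonneg[of M A] unfolding A_def by linarith
  have meas: "(\<lambda>u. prob {\<omega> \<in> space M. u < X \<omega>}) \<in> borel_measurable borel"
  proof -
    have "mono (\<lambda>u. - prob {\<omega> \<in> space M. u < X \<omega>})"
      by (auto intro!: monoI finite_measure_mono)
    from borel_measurable_mono[OF this]
    have "(\<lambda>u. - (- prob {\<omega> \<in> space M. u < X \<omega>})) \<in> borel_measurable borel"
      by (rule borel_measurable_uminus)
    then show ?thesis by simp
  qed
  interpret P: pair_sigma_finite M lborel ..
  have meas2: "(\<lambda>(\<omega>, u). indicator {p. x < snd p \<and> snd p < X (fst p)} (\<omega>, u) :: ennreal) \<in> borel_measurable (M \<Otimes>\<^sub>M lborel)"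
    by measurable
  have layer: "(\<integral>\<^sup>+\<omega>. ennreal (indicator A \<omega> * (X \<omega> - x)) \<partial>M)
      = (\<integral>\<^sup>+u. ennreal (indicator {x<..} u * prob {\<omega> \<in> space M. u < X \<omega>}) \<partial>lborel)"
  proof -
    have "(\<integral>\<^sup>+\<omega>. ennreal (indicator A \<omega> * (X \<omega> - x)) \<partial>M)
      = (\<integral>\<^sup>+\<omega>. (\<integral>\<^sup>+u. indicator {p. x < snd p \<and> snd p < X (fst p)} (\<omega>, u) \<partial>lborel) \<partial>M)"
    proof (rule nn_integral_cong)
      fix \<omega> assume "\<omega> \<in> space M"
      have "(\<integral>\<^sup>+u. indicator {p. x < snd p \<and> snd p < X (fst p)} (\<omega>, u) \<partial>lborel)
          = (\<integral>\<^sup>+u. indicator {x<..<X \<omega>} u \<partial>lborel)"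
        by (intro nn_integral_cong) (auto simp: indicator_def)
      also have "\<dots> = ennreal (indicator A \<omega> * (X \<omega> - x))"
        using \<open>\<omega> \<in> space M\<close> by (cases "x < X \<omega>") (auto simp: A_def)
      finally show "ennreal (indicator A \<omega> * (X \<omega> - x))
          = (\<integral>\<^sup>+u. indicator {p. x < snd p \<and> snd p < X (fst p)} (\<omega>, u) \<partial>lborel)" by simp
    qed
    also have "\<dots> = (\<integral>\<^sup>+u. (\<integral>\<^sup>+\<omega>. indicator {p. x < snd p \<and> snd p < X (fst p)} (\<omega>, u) \<partial>M) \<partial>lborel)"
      by (rule P.Fubini'[symmetric]) (use meas2 in simp)
    also have "\<dots> = (\<integral>\<^sup>+u. ennreal (indicator {x<..} u * prob {\<omega> \<in> space M. u < X \<omega>}) \<partial>lborel)"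
    proof (rule nn_integral_cong)
      fix u :: real
      have "(\<integral>\<^sup>+\<omega>. indicator {p. x < snd p \<and> snd p < X (fst p)} (\<omega>, u) \<partial>M)
          = (\<integral>\<^sup>+\<omega>. (if x < u then 1 else 0) * indicator {\<omega> \<in> space M. u < X \<omega>} \<omega> \<partial>M)"
        by (intro nn_integral_cong) (auto simp: indicator_def)
      also have "\<dots> = ennreal (indicator {x<..} u * prob {\<omega> \<in> space M. u < X \<omega>})"
        by (simp add: nn_integral_cmult emeasure_eq_measure)
      finally show "(\<integral>\<^sup>+\<omega>. indicator {p. x < snd p \<and> snd p < X (fst p)} (\<omega>, u) \<partial>M)
          = ennreal (indicator {x<..} u * prob {\<omega> \<in> space M. u < X \<omega>})" .
    qed
    finally show ?thesis .
  qed
  have "mrd M X x = (\<integral>\<omega>. (X \<omega> - x) \<partial>density M (\<lambda>\<omega>. ennreal (indicator A \<omega> / prob A)))"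
  proof -
    have "uniform_measure M A = density M (\<lambda>\<omega>. ennreal (indicator A \<omega> / prob A))"
      unfolding uniform_measure_def using pos
      by (intro arg_cong[where f = "density M"] ext)
         (auto simp: emeasure_eq_measure divide_ennreal indicator_def simp flip: ennreal_1)
    then show ?thesis unfolding mrd_def A_def by simp
  qed
  also have "\<dots> = (\<integral>\<omega>. (indicator A \<omega> / prob A) * (X \<omega> - x) \<partial>M)"
    by (subst integral_density) (auto simp: pos less_imp_le)
  also have "\<dots> = (\<integral>\<omega>. indicator A \<omega> * (X \<omega> - x) \<partial>M) / prob A"
    by simp
  also have "(\<integral>\<omega>. indicator A \<omega> * (X \<omega> - x) \<partial>M)
      = (\<integral>u. indicator {x<..} u * prob {\<omega> \<in> space M. u < X \<omega>} \<partial>lborel)"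
  proof -
    have "(\<integral>\<omega>. indicator A \<omega> * (X \<omega> - x) \<partial>M)
        = enn2real (\<integral>\<^sup>+\<omega>. ennreal (indicator A \<omega> * (X \<omega> - x)) \<partial>M)"
      by (rule integral_eq_nn_integral) (auto simp: A_def indicator_def)
    also have "\<dots> = enn2real (\<integral>\<^sup>+u. ennreal (indicator {x<..} u * prob {\<omega> \<in> space M. u < X \<omega>}) \<partial>lborel)"
      by (simp only: layer)
    also have "\<dots> = (\<integral>u. indicator {x<..} u * prob {\<omega> \<in> space M. u < X \<omega>} \<partial>lborel)"
      by (rule integral_eq_nn_integral[symmetric]) (use meas in auto)
    finally show ?thesis .
  qed
  finally show ?thesis
    by (simp add: tail A_def set_lebesgue_integral_def)
qed

lemma (in prob_space) gmrd_nonneg: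
  fixes X :: "'a \<Rightarrow> real"
  assumes [measurable]: "X \<in> borel_measurable M" and "0 \<le> x"
  shows "0 \<le> gmrd M X x"
proof -
  have "0 \<le> mrd M X x"
    unfolding mrd_def
  proof (rule integral_nonneg_AE, rule AE_uniform_measureI)
    show "{\<omega> \<in> space M. x < X \<omega>} \<in> sets M" by measurable
    show "AE \<omega> in M. \<omega> \<in> {\<omega> \<in> space M. x < X \<omega>} \<longrightarrow> 0 \<le> X \<omega> - x"
      by (rule AE_I2) simp
  qed
  with assms(2) show ?thesis unfolding gmrd_def by simp
qed

lemma (in prob_space) gmrd_tendsto_Lim:
  fixes X :: "'a \<Rightarrow> real"
  assumes "X \<in> borel_measurable M" "DGMRD M X" "upper_endpoint M X = \<infinity>"
  shows "(gmrd M X \<longlongrightarrow> Lim at_top (gmrd M X)) at_top"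
proof -
  let ?l = "gmrd M X"
  have anti: "?l y \<le> ?l x" if "0 < x" "x \<le> y" for x y
    using assms(2,3) that unfolding DGMRD_def by (auto simp: monotone_on_def)
  have bdd: "bdd_below (?l ` {0<..})"
  proof (rule bdd_belowI2)
    fix x :: real assume "x \<in> {0<..}"
    then show "0 \<le> ?l x" by (intro gmrd_nonneg assms(1)) simp
  qed
  have "(?l \<longlongrightarrow> Inf (?l ` {0<..})) at_top"
  proof (rule decreasing_tendsto)
    show "\<forall>\<^sub>F x in at_top. Inf (?l ` {0<..}) \<le> ?l x"
      using eventually_gt_at_top[of 0] 
    proof eventually_elim
      case (elim x)
      then show ?case by (intro cInf_lower bdd) simp
    qed
  next
    fix b assume "Inf (?l ` {0<..}) < b"
    then obtain x where x: "0 < x" "?l x < b"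
      using cInf_lessD[of "?l ` {0<..}" b] by auto
    show "\<forall>\<^sub>F y in at_top. ?l y < b"
      using eventually_ge_at_top[of x] 
    proof eventually_elim
      case (elim y)
      show ?case using anti[OF x(1) elim] x(2) by (rule le_less_trans)
    qed
  qed
  moreover from this have "Lim at_top ?l = Inf (?l ` {0<..})"
    by (intro tendsto_Lim trivial_limit_at_top_linorder)
  ultimately show ?thesis by simp
qed

end

theory Submission
  imports Defs
begin

text \<open>
  Everything is expressed through the expected excess \<open>g x = E (X - x)\<^sup>+\<close>. With
  \<open>T = 1 - F\<close> the tail of the distribution, \<open>\<ell> x = g x / (x * T x)\<close>, and continuity of the
  distribution function makes \<open>g\<close> differentiable with \<open>g' = - T\<close>. Hence
  \<open>(x\<^sup>b g x)' = x\<^bsup>b-1\<^esup> (b g x - x T x)\<close>, whose sign is decided by comparing \<open>\<ell> x\<close> with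
  \<open>1/b\<close>.

  Suppose \<open>c \<ge> 1/\<beta>\<close>. As \<open>\<ell>\<close> decreases to \<open>c\<close>, it is at least \<open>1/\<beta>\<close> everywhere, so
  \<open>x\<^sup>\<beta> g x\<close> is nondecreasing and stays above \<open>g 1 > 0\<close> for \<open>x \<ge> 1\<close>. But
  \<open>x\<^sup>\<beta> (X - x)\<^sup>+ \<le> X\<^bsup>\<beta>+1\<^esup>\<close>, so a finite moment of order \<open>\<beta> + 1\<close> would force
  \<open>x\<^sup>\<beta> g x \<rightarrow> 0\<close> by dominated convergence (\<open>powr_excess_tendsto_0\<close>).

  Suppose \<open>c < 1/\<beta>\<close>. Then \<open>\<ell> \<le> 1/\<gamma>\<close> eventually for some \<open>\<gamma> > \<beta>\<close>, so
  \<open>x\<^sup>\<gamma> g x\<close> is eventually nonincreasing and \<open>g x = O(x\<^bsup>-\<gamma>\<^esup>)\<close>. This decay bounds the moment of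
  order \<open>\<beta> + 1\<close>: on dyadic blocks \<open>X\<^bsup>\<beta>+1\<^esup>\<close> is controlled by \<open>2\<^bsup>n\<beta>\<^esup> (X - 2\<^sup>n)\<^sup>+\<close>, and
  the expectations of these sum like a geometric series of ratio \<open>2\<^bsup>\<beta>-\<gamma>\<^esup>\<close>
  (\<open>integrable_powr_if_excess_le\<close>).
\<close>

section \<open>The expected excess over a level\<close>

text \<open>The expectation of the positive part of \<open>X - x\<close>, also known as the stop-loss transform
  or the integrated tail. Unlike the mean residual demand it is not conditioned on
  \<open>X > x\<close>.\<close>

definition excess :: "'a measure \<Rightarrow> ('a \<Rightarrow> real) \<Rightarrow> real \<Rightarrow> real" where
  "excess M X x = (\<integral>\<omega>. max (X \<omega> - x) 0 \<partial>M)"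

context prob_space
begin

lemma excess_nonneg: "0 \<le> excess M X x"
  unfolding excess_def by (rule integral_nonneg_AE) simp

lemma tail_eq_prob:
  fixes X :: "'a \<Rightarrow> real"
  assumes [measurable]: "X \<in> borel_measurable M"
  shows "1 - dist_fun M X x = prob {\<omega> \<in> space M. x < X \<omega>}"
proof -
  have "dist_fun M X x = prob {\<omega> \<in> space M. X \<omega> \<le> x}"
    unfolding dist_fun_def cdf_def
    by (subst measure_distr) (auto intro!: arg_cong[where f = prob])
  moreover have "prob (space M - {\<omega> \<in> space M. X \<omega> \<le> x}) = 1 - prob {\<omega> \<in> space M. X \<omega> \<le> x}"
    by (rule prob_compl) measurable
  moreover have "space M - {\<omega> \<in> space M. X \<omega> \<le> x} = {\<omega> \<in> space M. x < X \<omega>}"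
    by auto
  ultimately show ?thesis by simp
qed

lemma tail_pos:
  fixes X :: "'a \<Rightarrow> real"
  assumes "X \<in> borel_measurable M" "upper_endpoint M X = \<infinity>" "0 \<le> x"
  shows "dist_fun M X x < 1"
proof -
  have "dist_fun M X x \<noteq> 1"
  proof
    assume "dist_fun M X x = 1"
    then have "upper_endpoint M X \<le> ereal x"
      unfolding upper_endpoint_def using assms(3) by (intro Inf_lower) auto
    with assms(2) show False by simp
  qed
  moreover have "0 \<le> 1 - dist_fun M X x"
    unfolding tail_eq_prob[OF assms(1)] by simp
  ultimately show ?thesis by simp
qed

lemma integrable_excess:
  fixes X :: "'a \<Rightarrow> real"
  assumes "integrable M X"
  shows "integrable M (\<lambda>\<omega>. max (X \<omega> - x) 0)"
  using assms by auto

lemma mrd_eq_excess: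
  fixes X :: "'a \<Rightarrow> real"
  assumes [measurable]: "X \<in> borel_measurable M" and lt: "dist_fun M X x < 1"
  shows "mrd M X x = excess M X x / (1 - dist_fun M X x)"
proof -
  define A where "A = {\<omega> \<in> space M. x < X \<omega>}"
  have [measurable]: "A \<in> sets M" unfolding A_def by measurable
  have pos: "prob A > 0"
    using lt tail_eq_prob[OF assms(1), of x] unfolding A_def by simp
  have "uniform_measure M A = density M (\<lambda>\<omega>. ennreal (indicator A \<omega> / prob A))"
    unfolding uniform_measure_def using pos
    by (intro arg_cong[where f = "density M"] ext)
       (auto simp: emeasure_eq_measure divide_ennreal indicator_def simp flip: ennreal_1)
  then have "mrd M X x = (\<integral>\<omega>. (X \<omega> - x) \<partial>density M (\<lambda>\<omega>. ennreal (indicator A \<omega> / prob A)))"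
    unfolding mrd_def A_def by simp
  also have "\<dots> = (\<integral>\<omega>. (indicator A \<omega> / prob A) * (X \<omega> - x) \<partial>M)"
    by (subst integral_density) (auto simp: pos less_imp_le)
  also have "\<dots> = (\<integral>\<omega>. max (X \<omega> - x) 0 / prob A \<partial>M)"
    by (rule Bochner_Integration.integral_cong) (auto simp: A_def indicator_def max_def)
  also have "\<dots> = excess M X x / prob A"
    unfolding excess_def by simp
  finally show ?thesis
    by (simp add: tail_eq_prob A_def)
qed

text \<open>For \<open>x \<le> y\<close> the difference \<open>(X - x)\<^sup>+ - (X - y)\<^sup>+\<close> lies between \<open>y - x\<close> times the
  indicators of \<open>X > y\<close> and of \<open>X > x\<close>.\<close>
lemma excess_diff_bounds:
  fixes X :: "'a \<Rightarrow> real"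
  assumes int: "integrable M X" and "x \<le> y"
  shows "(y - x) * (1 - dist_fun M X y) \<le> excess M X x - excess M X y"
    and "excess M X x - excess M X y \<le> (y - x) * (1 - dist_fun M X x)"
proof -
  have [measurable]: "X \<in> borel_measurable M" using int by simp
  have tail: "(y - x) * (1 - dist_fun M X t) = (\<integral>\<omega>. (y - x) * indicator {\<omega> \<in> space M. t < X \<omega>} \<omega> \<partial>M)" for t
    by (simp add: tail_eq_prob)
  have int_tail: "integrable M (\<lambda>\<omega>. (y - x) * indicator {\<omega> \<in> space M. t < X \<omega>} \<omega>)" for t
    by (intro integrable_mult_right integrable_real_indicator) (auto simp: less_top[symmetric])
  have diff: "excess M X x - excess M X y = (\<integral>\<omega>. max (X \<omega> - x) 0 - max (X \<omega> - y) 0 \<partial>M)"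
    unfolding excess_def by (intro Bochner_Integration.integral_diff[symmetric] integrable_excess int)
  show "(y - x) * (1 - dist_fun M X y) \<le> excess M X x - excess M X y"
    unfolding diff tail
    by (intro integral_mono int_tail Bochner_Integration.integrable_diff integrable_excess int)
       (use \<open>x \<le> y\<close> in \<open>auto simp: indicator_def\<close>)
  show "excess M X x - excess M X y \<le> (y - x) * (1 - dist_fun M X x)"
    unfolding diff tail
    by (intro integral_mono int_tail Bochner_Integration.integrable_diff integrable_excess int)
       (use \<open>x \<le> y\<close> in \<open>auto simp: indicator_def\<close>)
qed

lemma excess_has_derivative:
  fixes X :: "'a \<Rightarrow> real"
  assumes int: "integrable M X" and cont: "isCont (dist_fun M X) x"
  shows "(excess M X has_real_derivative - (1 - dist_fun M X x)) (at x)"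
proof -
  let ?F = "dist_fun M X"
  \<comment> \<open>The negated difference quotient lies between the tails at \<open>x\<close> and at \<open>y\<close>.\<close>
  have bound: "\<bar>(excess M X y - excess M X x) / (y - x) + (1 - ?F x)\<bar> \<le> \<bar>?F y - ?F x\<bar>"
    if "y \<noteq> x" for y
  proof (cases "x < y")
    case True
    have "(excess M X y - excess M X x) / (y - x) \<le> - (1 - ?F y)"
      "- (1 - ?F x) \<le> (excess M X y - excess M X x) / (y - x)"
      using excess_diff_bounds[OF int, of x y] True by (simp_all add: field_simps)
    then show ?thesis by linarith
  next
    case False
    then have "y < x" using that by simp
    have eq: "(excess M X y - excess M X x) / (y - x) = - ((excess M X y - excess M X x) / (x - y))"
      by (metis minus_diff_eq divide_minus_right)
    have "(1 - ?F x) \<le> (excess M X y - excess M X x) / (x - y)"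
      "(excess M X y - excess M X x) / (x - y) \<le> 1 - ?F y"
      using excess_diff_bounds[OF int, of y x] \<open>y < x\<close> by (simp_all add: field_simps)
    then show ?thesis unfolding eq by linarith
  qed
  have "((\<lambda>y. \<bar>?F y - ?F x\<bar>) \<longlongrightarrow> 0) (at x)"
    using cont unfolding isCont_def by (intro tendsto_rabs_zero) (simp add: LIM_zero)
  then have "((\<lambda>y. (excess M X y - excess M X x) / (y - x) + (1 - ?F x)) \<longlongrightarrow> 0) (at x)"
    by (rule Lim_null_comparison[rotated]) (use bound in \<open>auto simp: eventually_at_filter\<close>)
  then have "((\<lambda>y. (excess M X y - excess M X x) / (y - x)) \<longlongrightarrow> - (1 - ?F x)) (at x)"
    by - (rule LIM_zero_cancel, simp only: diff_minus_eq_add)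
  then show ?thesis
    by (simp add: has_field_derivative_iff)
qed

section \<open>Decay of the excess and finiteness of moments\<close>

lemma powr_excess_has_derivative:
  fixes X :: "'a \<Rightarrow> real"
  assumes "integrable M X" "isCont (dist_fun M X) x" "0 < x"
  shows "((\<lambda>x. x powr b * excess M X x) has_real_derivative
    x powr (b - 1) * (b * excess M X x - x * (1 - dist_fun M X x))) (at x)"
proof -
  have *: "x powr b = x powr (b - 1) * x"
    using assms(3) by (simp add: powr_diff)
  show ?thesis
    using DERIV_mult[OF has_real_derivative_powr[OF assms(3), of b] excess_has_derivative[OF assms(1,2)]]
    by (rule DERIV_cong) (simp add: * algebra_simps)
qed

lemma powr_excess_tendsto_0:
  fixes X :: "'a \<Rightarrow> real"
  assumes [measurable]: "X \<in> borel_measurable M" and "0 < b"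
    and int: "integrable M (\<lambda>\<omega>. X \<omega> powr (b + 1))"
  shows "((\<lambda>x. x powr b * excess M X x) \<longlongrightarrow> 0) at_top"
proof -
  have "((\<lambda>x. \<integral>\<omega>. x powr b * max (X \<omega> - x) 0 \<partial>M) \<longlongrightarrow> (\<integral>\<omega>. 0 \<partial>M)) at_top"
  proof (rule integral_dominated_convergence_at_top[OF _ _ int])
    show "\<forall>\<^sub>F x in at_top. AE \<omega> in M. norm (x powr b * max (X \<omega> - x) 0) \<le> X \<omega> powr (b + 1)"
      using eventually_gt_at_top[of 0]
    proof eventually_elim
      case (elim x)
      have "x powr b * max (X \<omega> - x) 0 \<le> X \<omega> powr (b + 1)" for \<omega>
      proof (cases "x < X \<omega>")
        case True
        then have "x powr b * (X \<omega> - x) \<le> X \<omega> powr b * X \<omega>"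
          using elim \<open>0 < b\<close> by (intro mult_mono powr_mono2) auto
        then show ?thesis using True elim by (simp add: powr_add)
      qed simp
      then show ?case using elim by (auto simp: abs_mult)
    qed
    show "AE \<omega> in M. ((\<lambda>x. x powr b * max (X \<omega> - x) 0) \<longlongrightarrow> 0) at_top"
    proof (rule AE_I2)
      fix \<omega>
      have "\<forall>\<^sub>F x in at_top. x powr b * max (X \<omega> - x) 0 = 0"
        using eventually_ge_at_top[of "X \<omega>"] by eventually_elim simp
      then show "((\<lambda>x. x powr b * max (X \<omega> - x) 0) \<longlongrightarrow> 0) at_top"
        by (rule tendsto_eventually)
    qed
  qed measurable
  then show ?thesis
    by (simp add: excess_def)
qed

text \<open>The index \<open>n\<close> is the one with \<open>2\<^bsup>n+1\<^esup> \<le> x < 2\<^bsup>n+2\<^esup>\<close>; starting the excess at \<open>2\<^sup>n\<close>,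
  one block lower, guarantees \<open>x \<le> 2 (x - 2\<^sup>n)\<close>.\<close>
lemma powr_le_dyadic_excess:
  fixes x b :: real
  assumes "2 \<le> x" "0 < b"
  obtains n :: nat where "x powr (b + 1) \<le> 2 * (2 ^ (n + 2)) powr b * max (x - 2 ^ n) 0"
proof -
  obtain m :: nat where m: "x < 2 ^ m"
    using real_arch_pow[of 2 x] by auto
  define k where "k = (LEAST m. x < (2::real) ^ m)"
  have k: "x < 2 ^ k" unfolding k_def using m by (rule LeastI)
  have "k \<noteq> 0" using k assms(1) by (intro notI) simp
  moreover have "k \<noteq> 1" using k assms(1) by (intro notI) simp
  ultimately have "k = (k - 2) + 2" by simp
  then obtain n where n: "k = n + 2" by blast
  have "\<not> x < 2 ^ (n + 1)"
    using not_less_Least[of "n + 1" "\<lambda>m. x < (2::real) ^ m"] n unfolding k_def by simp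
  then have "x \<le> 2 * (x - 2 ^ n)" by simp
  moreover have "x powr b \<le> (2 ^ (n + 2)) powr b"
    using k n assms by (intro powr_mono2) auto
  ultimately have "x powr b * x \<le> (2 ^ (n + 2)) powr b * (2 * (x - 2 ^ n))"
    using assms by (intro mult_mono) auto
  also have "\<dots> \<le> (2 ^ (n + 2)) powr b * (2 * max (x - 2 ^ n) 0)"
    by (intro mult_left_mono) auto
  finally show ?thesis
    using that[of n] assms by (simp add: powr_add mult_ac)
qed

text \<open>Strictness of \<open>b < g\<close> is what makes the dyadic series converge: a decay of exact order \<open>b\<close>
  gives only a weak moment of order \<open>b + 1\<close>.\<close>
lemma integrable_powr_if_excess_le:
  fixes X :: "'a \<Rightarrow> real"
  assumes int: "integrable M X" and nonneg: "AE \<omega> in M. 0 \<le> X \<omega>" and b: "0 < b" "b < g"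
    and le: "\<forall>\<^sub>F x in at_top. excess M X x \<le> K * x powr - g"
  shows "integrable M (\<lambda>\<omega>. X \<omega> powr (b + 1))"
proof (rule integrableI_bounded)
  have [measurable]: "X \<in> borel_measurable M" using int by simp
  show "(\<lambda>\<omega>. X \<omega> powr (b + 1)) \<in> borel_measurable M" by measurable
  define a where "a n = 2 * (2 ^ (n + 2)) powr b" for n :: nat
  have a_nonneg: "0 \<le> a n" for n unfolding a_def by simp
  define q where "q = 2 powr (b - g)"
  have q: "0 < q" "q < 1" unfolding q_def using b by (auto intro!: powr_less_one)
  have pow: "(2 ^ n) powr t = (2 powr t) ^ n" for t :: real and n :: nat
    by (simp add: powr_powr mult.commute flip: powr_realpow)
  have ev: "\<forall>\<^sub>F n in sequentially. norm (a n * excess M X (2 ^ n)) \<le> 2 * 4 powr b * K * q ^ n"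
  proof -
    have "filterlim (\<lambda>n. 2 ^ n :: real) at_top sequentially"
      by (rule filterlim_at_top_mono[OF filterlim_real_sequentially])
         (simp add: less_imp_le of_nat_less_two_power)
    from eventually_compose_filterlim[OF le this] show ?thesis
    proof eventually_elim
      case (elim n)
      have "norm (a n * excess M X (2 ^ n)) = a n * excess M X (2 ^ n)"
        using a_nonneg excess_nonneg by simp
      also have "\<dots> \<le> a n * (K * (2 ^ n) powr - g)"
        by (rule mult_left_mono[OF elim a_nonneg])
      also have "\<dots> = 2 * 4 powr b * ((2 ^ n) powr b) * (K * (2 ^ n) powr - g)"
        by (simp add: a_def powr_mult power_add)
      also have "\<dots> = 2 * 4 powr b * K * (2 ^ n) powr (b - g)"
        by (simp add: powr_diff powr_minus field_simps)
      finally show ?case by (simp add: q_def pow)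
    qed
  qed
  have "summable (\<lambda>n. a n * excess M X (2 ^ n))"
    by (rule summable_comparison_test_ev[OF ev]) (use q in \<open>auto intro!: summable_mult summable_geometric\<close>)
  then have fin: "(\<Sum>n. ennreal (a n * excess M X (2 ^ n))) \<noteq> \<top>"
    by (rule ennreal_suminf_neq_top) (simp add: a_nonneg excess_nonneg)
  have nn_term: "(\<integral>\<^sup>+\<omega>. ennreal (a n * max (X \<omega> - 2 ^ n) 0) \<partial>M) = ennreal (a n * excess M X (2 ^ n))" for n
    unfolding excess_def using integrable_excess[OF int] a_nonneg
    by (subst nn_integral_eq_integral) auto
  have "(\<integral>\<^sup>+\<omega>. ennreal (norm (X \<omega> powr (b + 1))) \<partial>M)
      \<le> (\<integral>\<^sup>+\<omega>. ennreal (2 powr (b + 1)) + (\<Sum>n. ennreal (a n * max (X \<omega> - 2 ^ n) 0)) \<partial>M)"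
  proof (rule nn_integral_mono_AE)
    show "AE \<omega> in M. ennreal (norm (X \<omega> powr (b + 1)))
      \<le> ennreal (2 powr (b + 1)) + (\<Sum>n. ennreal (a n * max (X \<omega> - 2 ^ n) 0))"
      using nonneg
    proof eventually_elim
      case (elim \<omega>)
      show ?case
      proof (cases "2 \<le> X \<omega>")
        case True
        obtain n where "X \<omega> powr (b + 1) \<le> a n * max (X \<omega> - 2 ^ n) 0"
          using powr_le_dyadic_excess[OF True b(1)] unfolding a_def by metis
        then have "ennreal (norm (X \<omega> powr (b + 1))) \<le> ennreal (a n * max (X \<omega> - 2 ^ n) 0)"
          by (simp add: ennreal_leI)
        also have "\<dots> = (\<Sum>n\<in>{n}. ennreal (a n * max (X \<omega> - 2 ^ n) 0))" by simp
        also have "\<dots> \<le> (\<Sum>n. ennreal (a n * max (X \<omega> - 2 ^ n) 0))"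
          by (rule sum_le_suminf) auto
        finally show ?thesis by (rule order_trans) simp
      next
        case False
        then have "X \<omega> powr (b + 1) \<le> 2 powr (b + 1)"
          using elim b by (intro powr_mono2) auto
        then have "ennreal (norm (X \<omega> powr (b + 1))) \<le> ennreal (2 powr (b + 1))"
          by (simp add: ennreal_leI)
        then show ?thesis by (rule order_trans) simp
      qed
    qed
  qed
  also have "\<dots> = ennreal (2 powr (b + 1)) + (\<Sum>n. ennreal (a n * excess M X (2 ^ n)))"
    by (subst nn_integral_add) (auto simp: nn_integral_suminf nn_term emeasure_space_1)
  also have "\<dots> < \<infinity>"
    using fin by (simp add: less_top)
  finally show "(\<integral>\<^sup>+\<omega>. ennreal (norm (X \<omega> powr (b + 1))) \<partial>M) < \<infinity>" .
qed

end

section \<open>Moments and the limit of the generalized mean residual demand\<close>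

theorem theorem3p4:
  fixes M :: "'a measure" and X :: "'a \<Rightarrow> real" and c :: real
  assumes "prob_space M"
    and "X \<in> borel_measurable M"
    and "AE \<omega> in M. 0 \<le> X \<omega>"
    and "DGMRD M X"
    and "continuous_on UNIV (dist_fun M X)"
    and "upper_endpoint M X = \<infinity>"
    and "integrable M X"
    and "c = Lim at_top (gmrd M X)"
  shows "(\<forall>\<beta>::real. \<beta> > 0 \<longrightarrow> (c < 1 / \<beta> \<longleftrightarrow> integrable M (\<lambda>\<omega>. X \<omega> powr (\<beta> + 1))))
    \<and> (c = 0 \<longleftrightarrow> (\<forall>\<beta>::real. \<beta> > 0 \<longrightarrow> integrable M (\<lambda>\<omega>. X \<omega> powr (\<beta> + 1))))"
proof -
  interpret prob_space M by fact
  let ?G = "excess M X" and ?F = "dist_fun M X" and ?l = "gmrd M X"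
  have cont: "isCont ?F x" for x
    using assms(5) by (simp add: continuous_on_eq_continuous_at)
  have F_lt: "?F x < 1" if "0 < x" for x
    using tail_pos[OF assms(2,6)] that by simp
  have l_eq: "?l x * (x * (1 - ?F x)) = ?G x" if "0 < x" for x
    using mrd_eq_excess[OF assms(2) F_lt[OF that]] F_lt[OF that] that by (simp add: gmrd_def)
  have lim: "(?l \<longlongrightarrow> c) at_top"
    unfolding assms(8) by (rule gmrd_tendsto_Lim[OF assms(2,4,6)])
  have c_le: "c \<le> ?l x" if "0 < x" for x
  proof (rule tendsto_upperbound[OF lim])
    show "\<forall>\<^sub>F y in at_top. ?l y \<le> ?l x"
      using eventually_ge_at_top[of x]
      by eventually_elim (use assms(4,6) that in \<open>auto simp: DGMRD_def monotone_on_def\<close>)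
  qed simp
  have c_nonneg: "0 \<le> c"
  proof (rule tendsto_lowerbound[OF lim])
    show "\<forall>\<^sub>F x in at_top. 0 \<le> ?l x"
      using eventually_ge_at_top[of 0] by eventually_elim (rule gmrd_nonneg[OF assms(2)])
  qed simp
  have G_pos: "0 < ?G 1"
  proof -
    have "0 < 1 - ?F 2" using F_lt[of 2] by simp
    also have "\<dots> \<le> ?G 1 - ?G 2" using excess_diff_bounds(1)[OF assms(7), of 1 2] by simp
    also have "\<dots> \<le> ?G 1" using excess_nonneg[of X 2] by simp
    finally show ?thesis .
  qed
  have main: "c < 1 / \<beta> \<longleftrightarrow> integrable M (\<lambda>\<omega>. X \<omega> powr (\<beta> + 1))" if "\<beta> > 0" for \<beta>
  proof
    assume "c < 1 / \<beta>"
    then obtain d where d: "c < d" "d < 1 / \<beta>" using dense by blast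
    have "0 < d" using c_nonneg d by simp
    define \<gamma> where "\<gamma> = 1 / d"
    have \<gamma>: "0 < \<gamma>" "\<beta> < \<gamma>" using d \<open>0 < d\<close> that by (auto simp: \<gamma>_def field_simps)
    obtain x0 where x0: "\<And>x. x0 \<le> x \<Longrightarrow> ?l x < d"
      using order_tendstoD(2)[OF lim d(1)] unfolding eventually_at_top_linorder by auto
    \<comment> \<open>Monotonicity is only available on the positive half-line.\<close>
    define y where "y = max x0 1"
    have y: "0 < y" "x0 \<le> y" unfolding y_def by auto
    have mono: "x powr \<gamma> * ?G x \<le> y powr \<gamma> * ?G y" if "y \<le> x" for x
    proof (rule DERIV_nonpos_imp_nonincreasing[OF that])
      fix t assume t: "y \<le> t" "t \<le> x"
      have "0 < t" using y t by simp
      have "?G t \<le> d * (t * (1 - ?F t))"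
        unfolding l_eq[OF \<open>0 < t\<close>, symmetric]
        using x0[of t] y t \<open>0 < t\<close> F_lt[of t] by (intro mult_right_mono) auto
      then have "\<gamma> * ?G t - t * (1 - ?F t) \<le> 0"
        using \<open>0 < d\<close> by (simp add: \<gamma>_def field_simps)
      then show "\<exists>D. ((\<lambda>x. x powr \<gamma> * ?G x) has_real_derivative D) (at t) \<and> D \<le> 0"
        using powr_excess_has_derivative[OF assms(7) cont \<open>0 < t\<close>, of \<gamma>]
        by (blast intro: mult_nonneg_nonpos powr_ge_zero)
    qed
    have "\<forall>\<^sub>F x in at_top. ?G x \<le> (y powr \<gamma> * ?G y) * x powr - \<gamma>"
      using eventually_ge_at_top[of y]
    proof eventually_elim
      case (elim x)
      then show ?case using mono[OF elim] y by (simp add: powr_minus field_simps)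
    qed
    then show "integrable M (\<lambda>\<omega>. X \<omega> powr (\<beta> + 1))"
      by (rule integrable_powr_if_excess_le[OF assms(7,3) that \<gamma>(2)])
  next
    assume "integrable M (\<lambda>\<omega>. X \<omega> powr (\<beta> + 1))"
    then have to0: "((\<lambda>x. x powr \<beta> * ?G x) \<longlongrightarrow> 0) at_top"
      by (rule powr_excess_tendsto_0[OF assms(2) that])
    show "c < 1 / \<beta>"
    proof (rule ccontr)
      assume "\<not> c < 1 / \<beta>"
      have mono: "1 powr \<beta> * ?G 1 \<le> x powr \<beta> * ?G x" if "1 \<le> x" for x
      proof (rule DERIV_nonneg_imp_nondecreasing[OF that])
        fix t assume t: "1 \<le> t" "t \<le> x"
        have "0 < t" using t by simp
        have "1 / \<beta> * (t * (1 - ?F t)) \<le> ?G t"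
          unfolding l_eq[OF \<open>0 < t\<close>, symmetric]
          using c_le[of t] \<open>\<not> c < 1 / \<beta>\<close> \<open>0 < t\<close> F_lt[of t] by (intro mult_right_mono) auto
        then have "0 \<le> \<beta> * ?G t - t * (1 - ?F t)"
          using \<open>\<beta> > 0\<close> by (simp add: field_simps)
        then show "\<exists>D. ((\<lambda>x. x powr \<beta> * ?G x) has_real_derivative D) (at t) \<and> 0 \<le> D"
          using powr_excess_has_derivative[OF assms(7) cont \<open>0 < t\<close>, of \<beta>]
          by (blast intro: mult_nonneg_nonneg powr_ge_zero)
      qed
      have "1 powr \<beta> * ?G 1 \<le> 0"
        by (rule tendsto_lowerbound[OF to0])
           (use mono in \<open>auto intro!: eventually_mono[OF eventually_ge_at_top[of 1]]\<close>)
      with G_pos show False by simp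
    qed
  qed
  have "c = 0 \<longleftrightarrow> (\<forall>\<beta>>0. c < 1 / \<beta>)"
  proof
    assume "\<forall>\<beta>>0. c < 1 / \<beta>"
    \<comment> \<open>If \<open>c > 0\<close>, then \<open>\<beta> = 1 / c\<close> would give \<open>c < c\<close>.\<close>
    then have "\<not> 0 < c"
      by (metis divide_divide_eq_right div_by_1 less_irrefl mult_1 zero_less_divide_1_iff)
    with c_nonneg show "c = 0" by simp
  qed simp
  with main show ?thesis by blast
qed

end
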